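(* Let $X$ be a topological space that is an $nq$-space, i.e. a space for which the nonquasiregularity degree $nq(X)$ is defined. Then $d(X)\leq\pi\chi(X)^{c(X)\cdot nq(X)}$.
   Context: No separation axioms are assumed unless stated. Cardinal functions follow Juhász's conventions; in particular $\pi\chi(X)$ and $c(X)$ are by convention infinite cardinals. The density $d(X)$ is the least cardinality of a dense subset of $X$. A local $\pi$-base at $x\in X$ is a family $\mathcal{B}$ of nonempty open subsets of $X$ such that every open set containing $x$ contains a member of $\mathcal{B}$. The $\pi$-character $\pi\chi(X)$ is the least infinite cardinal $\lambda$ such that every $x\in X$ has a local $\pi$-base of cardinality at most $\lambda$. The cellularity $c(X)$ is the least infinite cardinal $\kappa$ such that every family of pairwise disjoint nonempty open subsets of $X$ has cardinality at most $\kappa$. The nonquasiregularity degree $nq(X)$ is the least infinite cardinal $\kappa$ such that for every nonempty open set $U\subseteq X$ there is a family $\mathcal{V}$ of open subsets of $X$ with $|\mathcal{V}|\leq\kappa$, such that $G=\bigcap\mathcal{V}$ is a nonempty subset of $U$ and $\bigcap_{V\in\mathcal{V}}\overline{V}\subseteq U$. If such a $\kappa$ exists, $nq(X)$ is said to be defined and $X$ is called an $nq$-space. *)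

theory Defs
  imports "HOL-Analysis.Abstract_Topology"
begin

unbundle cardinal_syntax

text \<open>
  Cardinals are the cardinal orders of \<^theory>\<open>HOL.BNF_Cardinal_Order_Relation\<close>, compared by
  the heterogeneous relation \<open>\<le>o\<close>. ``The least cardinal such that'' is determined up to \<open>=o\<close>
  once the type \<open>'k\<close> carrying the candidates is large enough, and the choice operator
  picks a representative.
\<close>

definition least_cardinal :: "('k rel \<Rightarrow> bool) \<Rightarrow> 'k rel" where
  "least_cardinal P =
    (SOME \<kappa>. Card_order \<kappa> \<and> P \<kappa> \<and> (\<forall>\<mu>::'k rel. Card_order \<mu> \<and> P \<mu> \<longrightarrow> \<kappa> \<le>o \<mu>))"

lemma least_cardinal:
  fixes P :: "'k rel \<Rightarrow> bool"
  assumes "Card_order \<mu>" "P \<mu>"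
  shows "Card_order (least_cardinal P)" "P (least_cardinal P)" "least_cardinal P \<le>o \<mu>"
proof -
  have "\<exists>\<kappa>\<in>{\<mu>. Card_order \<mu> \<and> P \<mu>}. \<forall>\<mu>\<in>{\<mu>. Card_order \<mu> \<and> P \<mu>}. \<kappa> \<le>o \<mu>"
    using assms by (intro exists_minim_Card_order) auto
  then have "\<exists>\<kappa>. Card_order \<kappa> \<and> P \<kappa> \<and> (\<forall>\<mu>::'k rel. Card_order \<mu> \<and> P \<mu> \<longrightarrow> \<kappa> \<le>o \<mu>)"
    by auto
  from someI_ex[OF this]
  show "Card_order (least_cardinal P)" "P (least_cardinal P)" "least_cardinal P \<le>o \<mu>"
    using assms unfolding least_cardinal_def by blast+
qed

text \<open>
  The density is not required to be infinite. Its candidates are cardinalities of subsets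
  of \<open>'a\<close>, so they are realised on \<open>'a\<close> itself.
\<close>

definition density :: "'a topology \<Rightarrow> 'a rel" where
  "density X =
    least_cardinal (\<lambda>\<kappa>. \<exists>D. D \<subseteq> topspace X \<and> X closure_of D = topspace X \<and> |D| =o \<kappa>)"

text \<open>
  The other cardinal functions live on \<^typ>\<open>'a set + nat\<close>: every family of open sets has
  cardinality at most \<open>|UNIV :: 'a set set|\<close>, and the summand \<^typ>\<open>nat\<close> provides an infinite
  cardinal when \<open>'a\<close> is finite. Hence no smaller value is missed and no value
  is absent for lack of room.
\<close>

definition local_pi_base :: "'a topology \<Rightarrow> 'a \<Rightarrow> 'a set set \<Rightarrow> bool" where
  "local_pi_base X x \<B> \<longleftrightarrow>
    (\<forall>B\<in>\<B>. openin X B \<and> B \<noteq> {}) \<and>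
    (\<forall>U. openin X U \<and> x \<in> U \<longrightarrow> (\<exists>B\<in>\<B>. B \<subseteq> U))"

definition pi_character :: "'a topology \<Rightarrow> ('a set + nat) rel" where
  "pi_character X =
    least_cardinal (\<lambda>\<kappa>. cinfinite \<kappa> \<and>
      (\<forall>x\<in>topspace X. \<exists>\<B>. local_pi_base X x \<B> \<and> |\<B>| \<le>o \<kappa>))"

definition cellularity :: "'a topology \<Rightarrow> ('a set + nat) rel" where
  "cellularity X =
    least_cardinal (\<lambda>\<kappa>. cinfinite \<kappa> \<and>
      (\<forall>\<U>. (\<forall>U\<in>\<U>. openin X U \<and> U \<noteq> {}) \<and> pairwise disjnt \<U> \<longrightarrow> |\<U>| \<le>o \<kappa>))"

text \<open>
  The empty family needs no special treatment below: \<open>\<Inter>{} = UNIV\<close> is contained in \<open>U\<close> only if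
  \<open>U = UNIV = topspace X\<close>, and then \<open>{U}\<close> is a witness as well.
\<close>

definition nq_bound :: "'a topology \<Rightarrow> 'k rel \<Rightarrow> bool" where
  "nq_bound X \<kappa> \<longleftrightarrow>
    (\<forall>U. openin X U \<and> U \<noteq> {} \<longrightarrow>
      (\<exists>\<V>. (\<forall>V\<in>\<V>. openin X V) \<and> |\<V>| \<le>o \<kappa> \<and>
        \<Inter>\<V> \<noteq> {} \<and> \<Inter>\<V> \<subseteq> U \<and> (\<Inter>V\<in>\<V>. X closure_of V) \<subseteq> U))"

definition nq_space :: "'a topology \<Rightarrow> bool" where
  "nq_space X \<longleftrightarrow> (\<exists>\<kappa>::('a set + nat) rel. Cinfinite \<kappa> \<and> nq_bound X \<kappa>)"

text \<open>Only meaningful if \<open>nq_space X\<close> holds.\<close>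

definition nq_degree :: "'a topology \<Rightarrow> ('a set + nat) rel" where
  "nq_degree X = least_cardinal (\<lambda>\<kappa>. cinfinite \<kappa> \<and> nq_bound X \<kappa>)"

lemma card_of_family_le: "|\<A> :: 'a set set| \<le>o |UNIV :: ('a set + nat) set|"
  by (rule card_of_ordLeqI[of Inl]) auto

lemma Cinfinite_card_of_UNIV: "Cinfinite |UNIV :: ('a set + nat) set|"
  using card_of_Card_order by (auto simp: cinfinite_def Field_card_of finite_Plus_UNIV_iff)

lemma density_props:
  "Card_order (density X)"
  "\<exists>D. D \<subseteq> topspace X \<and> X closure_of D = topspace X \<and> |D| =o density X"
  "D \<subseteq> topspace X \<Longrightarrow> X closure_of D = topspace X \<Longrightarrow> density X \<le>o |D|"
proof -
  let ?P = "\<lambda>\<kappa>. \<exists>D. D \<subseteq> topspace X \<and> X closure_of D = topspace X \<and> |D| =o \<kappa>"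
  have P: "?P |D|" if "D \<subseteq> topspace X" "X closure_of D = topspace X" for D
    using that card_of_refl by blast
  have top: "?P |topspace X|"
    by (rule P) auto
  show "Card_order (density X)"
    "\<exists>D. D \<subseteq> topspace X \<and> X closure_of D = topspace X \<and> |D| =o density X"
    using least_cardinal(1,2)[of "|topspace X|" ?P, OF card_of_Card_order top]
    unfolding density_def by blast+
  show "density X \<le>o |D|" if "D \<subseteq> topspace X" "X closure_of D = topspace X"
    using least_cardinal(3)[of "|D|" ?P, OF card_of_Card_order P[OF that]]
    unfolding density_def .
qed

lemma pi_character_props:
  "Cinfinite (pi_character X)"
  "x \<in> topspace X \<Longrightarrow> \<exists>\<B>. local_pi_base X x \<B> \<and> |\<B>| \<le>o pi_character X"
proof -
  let ?P = "\<lambda>\<kappa>::('a set + nat) rel. cinfinite \<kappa> \<and>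
    (\<forall>x\<in>topspace X. \<exists>\<B>. local_pi_base X x \<B> \<and> |\<B>| \<le>o \<kappa>)"
  have "local_pi_base X x {B. openin X B \<and> B \<noteq> {}}" for x
    unfolding local_pi_base_def by blast
  then have P: "?P |UNIV|"
    using Cinfinite_card_of_UNIV card_of_family_le by blast
  note * = least_cardinal(1,2)[of _ ?P, OF card_of_Card_order P, folded pi_character_def]
  show "Cinfinite (pi_character X)"
    using * by blast
  show "\<exists>\<B>. local_pi_base X x \<B> \<and> |\<B>| \<le>o pi_character X" if "x \<in> topspace X"
    using * that by blast
qed

lemma cellularity_props:
  "Cinfinite (cellularity X)"
  "(\<And>U. U \<in> \<U> \<Longrightarrow> openin X U \<and> U \<noteq> {}) \<Longrightarrow> pairwise disjnt \<U> \<Longrightarrow> |\<U>| \<le>o cellularity X"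
proof -
  let ?P = "\<lambda>\<kappa>::('a set + nat) rel. cinfinite \<kappa> \<and>
    (\<forall>\<U>. (\<forall>U\<in>\<U>. openin X U \<and> U \<noteq> {}) \<and> pairwise disjnt \<U> \<longrightarrow> |\<U>| \<le>o \<kappa>)"
  have P: "?P |UNIV|"
    using Cinfinite_card_of_UNIV card_of_family_le by blast
  note * = least_cardinal(1,2)[of _ ?P, OF card_of_Card_order P, folded cellularity_def]
  show "Cinfinite (cellularity X)"
    using * by blast
  show "|\<U>| \<le>o cellularity X" if "\<And>U. U \<in> \<U> \<Longrightarrow> openin X U \<and> U \<noteq> {}" "pairwise disjnt \<U>"
    using * that by blast
qed

lemma nq_degree_props:
  assumes "nq_space X"
  shows "Cinfinite (nq_degree X)" "nq_bound X (nq_degree X)"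
proof -
  obtain \<kappa> :: "('a set + nat) rel" where \<kappa>: "Card_order \<kappa>" "cinfinite \<kappa> \<and> nq_bound X \<kappa>"
    using assms unfolding nq_space_def by blast
  note * = least_cardinal(1,2)[of \<kappa> "\<lambda>\<kappa>. cinfinite \<kappa> \<and> nq_bound X \<kappa>", OF \<kappa>, folded nq_degree_def]
  show "Cinfinite (nq_degree X)" "nq_bound X (nq_degree X)"
    using * by blast+
qed

end

theory Submission
  imports Defs
begin

text \<open>
  Let \<open>\<kappa> = c(X) \<cdot> nq(X)\<close> and \<open>\<mu> = \<pi>\<chi>(X)\<^sup>\<kappa>\<close>, so that \<open>\<mu>\<^sup>\<kappa> = \<mu>\<close>. Close off to a set \<open>D\<close> of at most \<open>\<mu>\<close>
  points such that, for any at most \<open>\<kappa>\<close> families \<open>\<C>\<close>, each of at most \<open>\<kappa>\<close> members of the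
  local \<open>\<pi>\<close>-bases at points of \<open>D\<close>, the closures of the sets \<open>\<Union>\<C>\<close> cover \<open>X\<close> as soon as they
  cover \<open>D\<close>. If \<open>D\<close> were not dense, take \<open>\<V>\<close> from the definition of \<open>nq(X)\<close> for
  \<open>U = X - cl D\<close>, and for each \<open>V \<in> \<V>\<close> a maximal disjoint family \<open>\<C> V\<close> of those
  \<open>\<pi>\<close>-base members that lie in \<open>X - cl V\<close>. By maximality \<open>cl (\<Union>(\<C> V))\<close> contains \<open>D - cl V\<close>, so
  these closures cover \<open>D\<close>; yet they all miss the nonempty set \<open>\<Inter>\<V>\<close>.
\<close>

text \<open>A nonempty \<open>C\<close> of this kind is the range of a function from
  \<open>Field \<kappa>\<close> to \<open>B\<close>, and there are at most \<mu>^\<kappa> \<le>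
  \<mu> such functions. The empty set is no such range, as \<open>Field \<kappa>\<close> is
  nonempty, and is counted separately.\<close>

lemma card_of_small_subsets:
  fixes \<kappa> :: "'k rel" and \<mu> :: "'m rel" and B :: "'b set"
  assumes \<kappa>: "Cinfinite \<kappa>" and \<mu>: "Cinfinite \<mu>" and exp: "\<mu> ^c \<kappa> \<le>o \<mu>" and B: "|B| \<le>o \<mu>"
  shows "|{C. C \<subseteq> B \<and> |C| \<le>o \<kappa>}| \<le>o \<mu>"
proof -
  let ?F = "Func (Field \<kappa>) B"
  have sub: "{C. C \<subseteq> B \<and> |C| \<le>o \<kappa>} \<subseteq> {{}} \<union> (\<lambda>g. g ` Field \<kappa>) ` ?F"
  proof (clarsimp)
    fix C assume C: "C \<subseteq> B" "|C| \<le>o \<kappa>" and nim: "C \<notin> (\<lambda>g. g ` Field \<kappa>) ` ?F"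
    show "C = {}"
    proof (rule ccontr)
      assume ne: "C \<noteq> {}"
      have "|C| \<le>o |Field \<kappa>|"
        using ordLeq_ordIso_trans[OF C(2) ordIso_symmetric[OF card_of_Field_ordIso]] \<kappa> by simp
      from iffD2[OF card_of_ordLeq2[OF ne] this] obtain g where g: "g ` Field \<kappa> = C" ..
      \<comment> \<open>\<open>Func\<close> admits only functions that are \<open>undefined\<close>
        off their domain, so \<open>g\<close> has to be cut down first.\<close>
      define h where "h = (\<lambda>k. if k \<in> Field \<kappa> then g k else undefined)"
      have "h \<in> ?F" "h ` Field \<kappa> = C"
        using g C(1) by (auto simp: h_def Func_def)
      then show False
        using nim by blast
    qed
  qed
  have "|?F| \<le>o |B| ^c \<kappa>"
    by (simp add: cexp_def Field_card_of card_of_refl ordIso_imp_ordLeq)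
  also have "|B| ^c \<kappa> \<le>o \<mu> ^c \<kappa>"
    using B \<kappa> by (blast intro: cexp_mono1)
  also note exp
  finally have "|?F| \<le>o \<mu>" .
  then have im: "|(\<lambda>g. g ` Field \<kappa>) ` ?F| \<le>o \<mu>"
    by (rule ordLeq_transitive[OF card_of_image])
  have "|{{} :: 'b set}| \<le>o \<mu>"
    by (rule ordLess_imp_ordLeq, rule finite_ordLess_infinite)
       (use \<mu> in \<open>auto simp: cinfinite_def Field_card_of card_order_on_well_order_on card_of_well_order_on\<close>)
  then have "|{{}} \<union> (\<lambda>g. g ` Field \<kappa>) ` ?F| \<le>o \<mu>"
    using im \<mu> by (rule Un_Cinfinite_bound)
  then show ?thesis
    by (rule ordLeq_transitive[OF card_of_mono1[OF sub]])
qed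

text \<open>Transfinite recursion along the well-order \<open>r\<close>, written as an inductive predicate.\<close>

inductive stage :: "'i rel \<Rightarrow> 'k rel \<Rightarrow> ('a set \<Rightarrow> 'a set) \<Rightarrow> 'i \<Rightarrow> 'a \<Rightarrow> bool"
  for r :: "'i rel" and \<kappa> :: "'k rel" and P :: "'a set \<Rightarrow> 'a set" where
  "\<forall>y\<in>S. \<exists>j\<in>underS r i. stage r \<kappa> P j y \<Longrightarrow> |S| \<le>o \<kappa> \<Longrightarrow> x \<in> P S \<Longrightarrow> stage r \<kappa> P i x"

lemma stage_mono:
  assumes "trans r" "antisym r" "(i, j) \<in> r" "stage r \<kappa> P i x"
  shows "stage r \<kappa> P j x"
proof -
  have "underS r i \<subseteq> underS r j"
    using assms(1-3) unfolding underS_def by (blast dest: transD antisymD)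
  moreover obtain S where "\<forall>y\<in>S. \<exists>k\<in>underS r i. stage r \<kappa> P k y" "|S| \<le>o \<kappa>" "x \<in> P S"
    using assms(4) by cases blast
  ultimately show ?thesis
    by (intro stage.intros[of S]) blast+
qed

text \<open>The operator \<open>P\<close> is iterated along the successor cardinal of \<kappa>. That
  cardinal is regular, so a set of size at most \<kappa> in the union of all stages lies in a single
  stage, and its image under \<open>P\<close> enters at any later one. Since \<mu>^\<kappa> \<le>
  \<mu>, each stage has size at most \<mu>.\<close>

lemma closing_off:
  fixes \<kappa> :: "'k rel" and \<mu> :: "'m rel" and P :: "'a set \<Rightarrow> 'a set"
  assumes \<kappa>: "Cinfinite \<kappa>" and \<mu>: "Cinfinite \<mu>" and exp: "\<mu> ^c \<kappa> \<le>o \<mu>"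
    and P: "\<And>S. |S| \<le>o \<kappa> \<Longrightarrow> |P S| \<le>o \<mu>"
  obtains D where "|D| \<le>o \<mu>" "\<And>S. S \<subseteq> D \<Longrightarrow> |S| \<le>o \<kappa> \<Longrightarrow> P S \<subseteq> D"
proof -
  let ?r = "cardSuc \<kappa>"
  define A where "A i = {x. stage ?r \<kappa> P i x}" for i
  have r: "Cinfinite ?r" "Card_order ?r" "Well_order ?r"
    using Cinfinite_cardSuc[OF \<kappa>] by (auto simp: card_order_on_def)
  then interpret r: wo_rel ?r
    by (simp add: wo_rel_def)
  \<comment> \<open>By Cantor, \<kappa> < 2^\<kappa> \<le> \<mu>^\<kappa> \<le> \<mu>; hence the
    recursion has at most \<mu> stages.\<close>
  have "\<kappa> <o \<mu>"
  proof -
    have "\<kappa> <o ctwo ^c \<kappa>"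
      using \<kappa> by (blast intro: ordLess_ctwo_cexp)
    also have "ctwo ^c \<kappa> \<le>o \<mu> ^c \<kappa>"
      using \<kappa> \<mu> by (blast intro: cexp_mono1 ctwo_ordLeq_Cinfinite)
    also note exp
    finally show ?thesis .
  qed
  then have r_le: "?r \<le>o \<mu>"
    using \<kappa> \<mu> cardSuc_ordLess_ordLeq by blast
  have mono: "A i \<subseteq> A j" if "(i, j) \<in> ?r" for i j
    using stage_mono[OF r.TRANS r.ANTISYM that] by (auto simp: A_def)
  have A_eq: "A i = (\<Union>S\<in>{S. S \<subseteq> (\<Union>j\<in>underS ?r i. A j) \<and> |S| \<le>o \<kappa>}. P S)" for i
  proof -
    have "stage ?r \<kappa> P i x \<longleftrightarrow>
        (\<exists>S. (\<forall>y\<in>S. \<exists>j\<in>underS ?r i. stage ?r \<kappa> P j y) \<and> |S| \<le>o \<kappa> \<and> x \<in> P S)" for x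
      by (subst stage.simps) blast
    then show ?thesis
      by (auto simp: A_def subset_iff)
  qed
  have Un: "|\<Union>j\<in>J. A j| \<le>o \<mu>"
    if "|J| \<le>o ?r" "\<And>j. j \<in> J \<Longrightarrow> |A j| \<le>o \<mu>" for J
    using that \<mu> ordLeq_transitive[OF _ r_le] by (blast intro: UNION_Cinfinite_bound)
  have A_le: "|A i| \<le>o \<mu>" if "i \<in> Field ?r" for i
    using that
  proof (induction i rule: r.well_order_induct)
    case (1 i)
    have "|\<Union>j\<in>underS ?r i. A j| \<le>o \<mu>"
    proof (rule Un)
      show "|underS ?r i| \<le>o ?r"
        using card_of_underS[OF r(2) 1(2)] by (rule ordLess_imp_ordLeq)
      show "|A j| \<le>o \<mu>" if "j \<in> underS ?r i" for j
        using 1 that unfolding underS_def by (blast intro: FieldI1)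
    qed
    then have "|{S. S \<subseteq> (\<Union>j\<in>underS ?r i. A j) \<and> |S| \<le>o \<kappa>}| \<le>o \<mu>"
      by (rule card_of_small_subsets[OF \<kappa> \<mu> exp])
    then show ?case
      unfolding A_eq[of i] using P \<mu> by (blast intro: UNION_Cinfinite_bound)
  qed
  define D where "D = (\<Union>i\<in>Field ?r. A i)"
  show thesis
  proof
    show "|D| \<le>o \<mu>"
      unfolding D_def using card_of_Field_ordIso[OF r(2)] A_le
      by (intro Un) (blast intro: ordIso_imp_ordLeq)+
    fix S assume S: "S \<subseteq> D" "|S| \<le>o \<kappa>"
    have "relChain ?r A"
      using mono by (simp add: relChain_def)
    then obtain i where i: "i \<in> Field ?r" "S \<subseteq> A i"
      using cardSuc_UNION_Cinfinite[OF \<kappa> _ _ S(2)] S(1) unfolding D_def by blast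
    \<comment> \<open>Stage \<open>i\<close> absorbs \<open>P S\<close> only for \<open>S\<close>
      taken from strictly earlier stages, so a later index is required. It exists because an
      infinite cardinal has no last element.\<close>
    obtain j where "j \<in> Field ?r" "i \<noteq> j" "(i, j) \<in> ?r"
      using infinite_Card_order_limit[OF r(2) _ i(1)] r(1) unfolding cinfinite_def by blast
    then have "i \<in> underS ?r j" "j \<in> Field ?r"
      by (auto simp: underS_def)
    then have "P S \<subseteq> A j"
      using i S(2) unfolding A_eq[of j] by blast
    then show "P S \<subseteq> D"
      using \<open>j \<in> Field ?r\<close> unfolding D_def by blast
  qed
qed

text \<open>Zorn's lemma for the disjoint subfamilies of \<open>\<P>\<close>: two members of the
  union of a chain lie in a common link, and a nonempty \<open>B\<close> missing every member of a
  maximal family could be added to it.\<close>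

lemma exists_maximal_disjoint_subfamily:
  "\<exists>\<C>\<subseteq>\<P>. pairwise disjnt \<C> \<and> (\<forall>B\<in>\<P>. B \<noteq> {} \<longrightarrow> (\<exists>C\<in>\<C>. B \<inter> C \<noteq> {}))"
proof -
  let ?A = "{\<C>. \<C> \<subseteq> \<P> \<and> pairwise disjnt \<C>}"
  have "\<exists>M\<in>?A. \<forall>Y\<in>?A. M \<subseteq> Y \<longrightarrow> Y = M"
  proof (rule subset_Zorn')
    fix C assume C: "subset.chain ?A C"
    then have ch: "\<And>x y. x \<in> C \<Longrightarrow> y \<in> C \<Longrightarrow> x \<subseteq> y \<or> y \<subseteq> x" and sub: "C \<subseteq> ?A"
      by (auto simp: subset_chain_def)
    have "pairwise disjnt (\<Union>C)"
      unfolding pairwise_def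
    proof (intro ballI impI)
      fix a b assume "a \<in> \<Union>C" "b \<in> \<Union>C" "a \<noteq> b"
      then obtain M where "M \<in> C" "a \<in> M" "b \<in> M"
        using ch by blast
      then show "disjnt a b"
        using sub pairwiseD[of disjnt M a b] \<open>a \<noteq> b\<close> by blast
    qed
    then show "\<Union>C \<in> ?A"
      using sub by blast
  qed
  then obtain M where "M \<in> ?A" and max': "\<forall>Y\<in>?A. M \<subseteq> Y \<longrightarrow> Y = M" ..
  then have M: "M \<subseteq> \<P>" "pairwise disjnt M"
    by simp_all
  have max: "Y = M" if "Y \<subseteq> \<P>" "pairwise disjnt Y" "M \<subseteq> Y" for Y
    using max' that by simp
  show ?thesis
  proof (intro exI[of _ M] conjI ballI impI)
    fix B assume B: "B \<in> \<P>" "B \<noteq> {}"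
    show "\<exists>C\<in>M. B \<inter> C \<noteq> {}"
    proof (rule ccontr)
      assume "\<not> ?thesis"
      then have disj: "\<And>C. C \<in> M \<Longrightarrow> disjnt B C"
        by (auto simp: disjnt_def)
      then have "pairwise disjnt (insert B M)"
        using M(2) by (auto simp: pairwise_insert disjnt_sym)
      then have "B \<in> M"
        using max[of "insert B M"] M(1) B(1) by blast
      \<comment> \<open>As a member of \<open>M\<close>, the set \<open>B\<close> would be disjoint
        from itself.\<close>
      then show False
        using disj B(2) by (auto simp: disjnt_def)
    qed
  qed (fact M)+
qed

theorem theorem2p6:
  fixes X :: "'a topology"
  assumes "nq_space X"
  shows "density X \<le>o pi_character X ^c (cellularity X *c nq_degree X)"
proof -
  define \<kappa> where "\<kappa> = cellularity X *c nq_degree X"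
  define \<mu> where "\<mu> = pi_character X ^c \<kappa>"
  note c = cellularity_props[where X = X] and nq = nq_degree_props[OF assms]
  note \<pi> = pi_character_props[where X = X]
  have \<kappa>: "Cinfinite \<kappa>"
    unfolding \<kappa>_def using c(1) nq(1) by (simp add: cinfinite_cprod Card_order_cprod)
  have c_le: "cellularity X \<le>o \<kappa>" and nq_le: "nq_degree X \<le>o \<kappa>"
    unfolding \<kappa>_def cprod_def using c(1) nq(1)
    by (auto simp: cinfinite_def intro!: Card_order_Times1 Card_order_Times2)
  have \<mu>: "Cinfinite \<mu>"
    unfolding \<mu>_def by (rule Cinfinite_cexp[OF ctwo_ordLeq_Cinfinite[OF \<pi>(1)] \<kappa>])
  have \<kappa>_le: "\<kappa> \<le>o \<mu>" and \<pi>_le: "pi_character X \<le>o \<mu>"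
    unfolding \<mu>_def using \<pi>(1) \<kappa>
    by (simp_all add: ordLeq_cexp1 ordLeq_cexp2 ctwo_ordLeq_Cinfinite cinfinite_not_czero)
  \<comment> \<open>(\<pi>^\<kappa>)^\<kappa> = \<pi>^(\<kappa> \<kappa>) = \<pi>^\<kappa>, where
    \<pi> is the \<pi>-character.\<close>
  have exp: "\<mu> ^c \<kappa> \<le>o \<mu>"
    unfolding \<mu>_def using \<pi>(1) \<kappa>
    by (intro ordIso_imp_ordLeq[OF cexp_cprod_ordLeq])
       (simp_all add: cinfinite_not_czero ordLeq_refl)
  have "\<forall>x\<in>topspace X. \<exists>\<B>. local_pi_base X x \<B> \<and> |\<B>| \<le>o \<mu>"
    using \<pi>(2) ordLeq_transitive[OF _ \<pi>_le] by blast
  from bchoice[OF this] obtain N where N: "\<And>x. x \<in> topspace X \<Longrightarrow> local_pi_base X x (N x)"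
    "\<And>x. x \<in> topspace X \<Longrightarrow> |N x| \<le>o \<mu>"
    by blast
  define E where "E S = (\<Union>x\<in>S \<inter> topspace X. N x)" for S
  define T where "T \<P> = topspace X - (\<Union>\<C>\<in>\<P>. X closure_of (\<Union>\<C>))" for \<P>
  \<comment> \<open>A point witnessing that the closures fail to cover the space. If they do cover
    it, the value is arbitrary and may lie outside the space, which is why \<open>D\<close> is later
    cut down to \<open>?D\<close>.\<close>
  define p where "p \<P> = (SOME x. x \<in> T \<P>)" for \<P>
  define P where "P S = p ` {\<P>. \<P> \<subseteq> {\<C>. \<C> \<subseteq> E S \<and> |\<C>| \<le>o \<kappa>} \<and> |\<P>| \<le>o \<kappa>}" for S
  have P_le: "|P S| \<le>o \<mu>" if "|S| \<le>o \<kappa>" for S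
  proof -
    have "|S \<inter> topspace X| \<le>o |S|"
      by (rule card_of_mono1) blast
    also note that
    also note \<kappa>_le
    finally have "|E S| \<le>o \<mu>"
      unfolding E_def by (rule UNION_Cinfinite_bound[OF _ _ \<mu>]) (simp add: N(2))
    \<comment> \<open>Small subsets are counted twice: first the families \<C> inside
      \<open>E S\<close>, then the collections \<P> of such families.\<close>
    then show ?thesis
      unfolding P_def
      by (intro ordLeq_transitive[OF card_of_image] card_of_small_subsets[OF \<kappa> \<mu> exp])
  qed
  obtain D where D: "|D| \<le>o \<mu>" "\<And>S. S \<subseteq> D \<Longrightarrow> |S| \<le>o \<kappa> \<Longrightarrow> P S \<subseteq> D"
    using closing_off[of \<kappa> \<mu> P, OF \<kappa> \<mu> exp P_le] by blast
  let ?D = "D \<inter> topspace X"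
  have dense: "X closure_of ?D = topspace X"
  proof (rule ccontr)
    define U where "U = topspace X - X closure_of ?D"
    assume "X closure_of ?D \<noteq> topspace X"
    then have "openin X U" "U \<noteq> {}"
      using closure_of_subset_topspace[of X ?D] by (auto simp: U_def)
    then obtain \<V> where \<V>: "\<And>V. V \<in> \<V> \<Longrightarrow> openin X V" "|\<V>| \<le>o nq_degree X"
      "\<Inter>\<V> \<noteq> {}" "\<Inter>\<V> \<subseteq> U" "(\<Inter>V\<in>\<V>. X closure_of V) \<subseteq> U"
      using nq(2) unfolding nq_bound_def by metis
    define W where "W V = topspace X - X closure_of V" for V
    have "\<forall>V. \<exists>\<C>\<subseteq>{B \<in> E D. B \<subseteq> W V}. pairwise disjnt \<C> \<and>
        (\<forall>B\<in>{B \<in> E D. B \<subseteq> W V}. B \<noteq> {} \<longrightarrow> (\<exists>C\<in>\<C>. B \<inter> C \<noteq> {}))"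
      by (intro allI exists_maximal_disjoint_subfamily)
    from choice[OF this] obtain \<C> where
      \<C>': "\<forall>V. \<C> V \<subseteq> {B \<in> E D. B \<subseteq> W V} \<and> pairwise disjnt (\<C> V) \<and>
        (\<forall>B\<in>{B \<in> E D. B \<subseteq> W V}. B \<noteq> {} \<longrightarrow> (\<exists>C\<in>\<C> V. B \<inter> C \<noteq> {}))" ..
    then have \<C>: "\<C> V \<subseteq> {B \<in> E D. B \<subseteq> W V}" "pairwise disjnt (\<C> V)" for V
      by simp_all
    have max: "\<exists>C\<in>\<C> V. B \<inter> C \<noteq> {}" if "B \<in> E D" "B \<subseteq> W V" "B \<noteq> {}" for B V
      using \<C>' that by simp
    have E_open: "openin X B" "B \<noteq> {}" if "B \<in> E D" for B
      using that N(1) unfolding E_def local_pi_base_def by blast+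
    have \<C>_le: "|\<C> V| \<le>o \<kappa>" for V
    proof (rule ordLeq_transitive[OF c(2) c_le])
      show "openin X B \<and> B \<noteq> {}" if "B \<in> \<C> V" for B
        using that \<C>(1) E_open by blast
    qed (rule \<C>(2))
    have \<V>_le: "|\<V>| \<le>o \<kappa>"
      using \<V>(2) nq_le by (rule ordLeq_transitive)
    have "|\<Union>V\<in>\<V>. \<C> V| \<le>o \<kappa>"
      by (rule UNION_Cinfinite_bound[OF \<V>_le _ \<kappa>]) (simp add: \<C>_le)
    then have image_le: "|f ` (\<Union>V\<in>\<V>. \<C> V)| \<le>o \<kappa>" for f :: "'a set \<Rightarrow> 'a"
      by (rule ordLeq_transitive[OF card_of_image])
    \<comment> \<open>Each chosen \<pi>-base member is charged to one point of \<open>?D\<close>.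
      These at most \<kappa> points form a set \<open>S\<close> to which the closure property of
      \<open>D\<close> applies.\<close>
    have "\<forall>B\<in>\<Union>V\<in>\<V>. \<C> V. \<exists>x. x \<in> ?D \<and> B \<in> N x"
      using \<C>(1) unfolding E_def by blast
    from bchoice[OF this]
    obtain s where s: "\<And>B. B \<in> (\<Union>V\<in>\<V>. \<C> V) \<Longrightarrow> s B \<in> ?D \<and> B \<in> N (s B)"
      by blast
    define S where "S = s ` (\<Union>V\<in>\<V>. \<C> V)"
    have "S \<subseteq> D"
      unfolding S_def using s by blast
    moreover have "|S| \<le>o \<kappa>"
      unfolding S_def by (rule image_le)
    ultimately have "P S \<subseteq> D"
      by (rule D(2))
    have "\<C> V \<subseteq> E S" if "V \<in> \<V>" for V
      using s that unfolding E_def S_def by blast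
    then have "\<C> ` \<V> \<subseteq> {\<C>. \<C> \<subseteq> E S \<and> |\<C>| \<le>o \<kappa>}"
      using \<C>_le by blast
    moreover have "|\<C> ` \<V>| \<le>o \<kappa>"
      by (rule ordLeq_transitive[OF card_of_image \<V>_le])
    ultimately have "p (\<C> ` \<V>) \<in> P S"
      unfolding P_def by blast
    then have "p (\<C> ` \<V>) \<in> D"
      using \<open>P S \<subseteq> D\<close> by blast
    moreover have "p (\<C> ` \<V>) \<in> T (\<C> ` \<V>)"
      unfolding p_def
    proof (rule someI_ex)
      \<comment> \<open>Any point of \<open>\<Inter>\<V>\<close> is uncovered: each \<open>V\<close>
        is an open neighbourhood of it that is disjoint from
        \<open>\<Union>(\<C> V)\<close>.\<close>
      obtain g where g: "g \<in> \<Inter>\<V>"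
        using \<V>(3) by blast
      have "g \<notin> X closure_of (\<Union>(\<C> V))" if "V \<in> \<V>" for V
      proof -
        have "W V \<inter> V = {}"
          using closure_of_subset[OF openin_subset[OF \<V>(1)[OF that]]] by (auto simp: W_def)
        then have "\<Union>(\<C> V) \<inter> V = {}"
          using \<C>(1) by blast
        then show ?thesis
          using \<V>(1)[OF that] g that unfolding in_closure_of by blast
      qed
      moreover have "g \<in> topspace X"
        using g \<V>(4) by (auto simp: U_def)
      ultimately show "\<exists>x. x \<in> T (\<C> ` \<V>)"
        unfolding T_def by blast
    qed
    ultimately obtain q where q: "q \<in> ?D" "q \<in> T (\<C> ` \<V>)"
      unfolding T_def by blast
    then have "q \<notin> U"
      using closure_of_subset[of ?D X] by (auto simp: U_def)
    \<comment> \<open>The intersection of the closures lies in \<open>U\<close>, so the point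
      \<open>q\<close> outside \<open>U\<close> must escape one of them.\<close>
    then obtain V where V: "V \<in> \<V>" "q \<notin> X closure_of V"
      using \<V>(5) by blast
    \<comment> \<open>An open neighbourhood of \<open>q\<close>. A member of \<open>N q\<close>
      inside it competes for \<open>\<C> V\<close>, so by maximality it meets some member of
      \<open>\<C> V\<close>, although \<open>?O\<close> avoids them all.\<close>
    let ?O = "W V - X closure_of (\<Union>(\<C> V))"
    have "openin X ?O"
      unfolding W_def by (intro openin_diff) auto
    moreover have "q \<in> ?O"
      using q V by (auto simp: W_def T_def)
    ultimately obtain B where B: "B \<in> N q" "B \<subseteq> ?O"
      using N(1) q(1) unfolding local_pi_base_def by blast
    then have "B \<in> E D"
      using q(1) by (auto simp: E_def)
    then obtain C where C: "C \<in> \<C> V" "B \<inter> C \<noteq> {}"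
      using max[of B V] B(2) E_open(2) by blast
    have "\<Union>(\<C> V) \<subseteq> topspace X"
      using \<C>(1)[of V] by (auto simp: W_def)
    then have "C \<subseteq> X closure_of (\<Union>(\<C> V))"
      using closure_of_subset C(1) by blast
    then show False
      using B(2) C(2) by blast
  qed
  have "density X \<le>o |?D|"
    using dense by (intro density_props(3)) auto
  also have "|?D| \<le>o |D|"
    by (rule card_of_mono1) blast
  also note D(1)
  finally show ?thesis
    by (simp add: \<mu>_def \<kappa>_def)
qed

end
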